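(* Let $G=(V,E)$ be a finite connected graph. At the end of the Explorer-Director game on $G$, the set $U$ of all visited vertices always contains a closed subset. That is: if at some point of a play $U \subseteq V$ is the set of vertices visited so far (including the token's current position $x \in U$), and from this point the Explorer has no strategy that forces the token, against every play of the Director, to reach a vertex of $V \setminus U$ after finitely many turns, then there is a closed set $W \subseteq U$.
   Context: $\mathrm{dist}(u,v)$ denotes the length of a shortest path between $u$ and $v$ in $G$. Explorer-Director game on $G$ with a given starting vertex: a token is initially at the starting vertex, which counts as visited. On each turn the Explorer names a distance $d$ such that at least one vertex of $G$ is at distance exactly $d$ from the token's current position, and then the Director moves the token to a vertex of their choice at distance exactly $d$ from the current position. The Explorer wants to maximize, and the Director to minimize, the number of distinct vertices visited by the token. The game ends when the Explorer can no longer force a visit to an unvisited vertex. Closed set: a non-empty subset $W \subseteq V$ is closed if for every $u \in W$ and every $v \in V$ there exists $y \in W$ with $\mathrm{dist}(u,v)=\mathrm{dist}(u,y)$, where distances are computed in $G$. *)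

theory Defs
  imports "Graph_Theory.Graph_Theory"
begin

text \<open>
  Finite simple graphs are rendered by the locale \<^locale>\<open>graph\<close> (finite, loop-free, symmetric
  digraphs without parallel arcs): an undirected edge is a pair of opposite arcs.
\<close>

text \<open>
  If \<open>v\<close> is not reachable from \<open>u\<close>, the value is unspecified; below, distances are only
  used between vertices of a connected graph.
\<close>

definition gdist :: "('a, 'b) pre_digraph \<Rightarrow> 'a \<Rightarrow> 'a \<Rightarrow> nat" where
  "gdist G u v = (LEAST n. \<exists>p. pre_digraph.apath G u p v \<and> length p = n)"

definition closed_set :: "('a, 'b) pre_digraph \<Rightarrow> 'a set \<Rightarrow> bool" where
  "closed_set G W \<longleftrightarrow> W \<noteq> {} \<and> W \<subseteq> verts G \<and>
     (\<forall>u\<in>W. \<forall>v\<in>verts G. \<exists>y\<in>W. gdist G u v = gdist G u y)"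

definition may_name :: "('a, 'b) pre_digraph \<Rightarrow> 'a \<Rightarrow> nat \<Rightarrow> bool" where
  "may_name G x d \<longleftrightarrow> (\<exists>v\<in>verts G. gdist G x v = d)"

text \<open>
  The finite plays from \<open>s\<close>, recorded as the list of token positions in chronological order:
  the visited vertices are the members of the list, and its last entry is the current position.
  The named distances are determined by consecutive positions and hence need not be recorded.
\<close>

inductive play :: "('a, 'b) pre_digraph \<Rightarrow> 'a \<Rightarrow> 'a list \<Rightarrow> bool"
  for G :: "('a, 'b) pre_digraph" and s :: 'a where
  start: "s \<in> verts G \<Longrightarrow> play G s [s]"
| turn: "\<lbrakk>play G s h; may_name G (last h) d; v \<in> verts G; gdist G (last h) v = d\<rbrakk>
    \<Longrightarrow> play G s (h @ [v])"

definition explorer_strategy :: "('a, 'b) pre_digraph \<Rightarrow> 'a \<Rightarrow> ('a list \<Rightarrow> nat) \<Rightarrow> bool" where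
  "explorer_strategy G s \<sigma> \<longleftrightarrow> (\<forall>h. play G s h \<longrightarrow> may_name G (last h) (\<sigma> h))"

text \<open>
  \<open>p\<close> is an infinite continuation of the play \<open>h\<close> in which the Explorer follows \<open>\<sigma>\<close> and the
  Director moves arbitrarily: \<open>p 0\<close> is the position reached by \<open>h\<close>, and \<open>p n\<close> is the position
  after \<open>n\<close> further turns. The strategy sees the whole history.
\<close>

definition continuation ::
  "('a, 'b) pre_digraph \<Rightarrow> ('a list \<Rightarrow> nat) \<Rightarrow> 'a list \<Rightarrow> (nat \<Rightarrow> 'a) \<Rightarrow> bool" where
  "continuation G \<sigma> h p \<longleftrightarrow> p 0 = last h \<and>
     (\<forall>n. p (Suc n) \<in> verts G \<and>
          gdist G (p n) (p (Suc n)) = \<sigma> (h @ map p [1..<Suc n]))"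

definition can_force_new ::
  "('a, 'b) pre_digraph \<Rightarrow> 'a \<Rightarrow> 'a list \<Rightarrow> bool" where
  "can_force_new G s h \<longleftrightarrow>
     (\<exists>\<sigma>. explorer_strategy G s \<sigma> \<and>
        (\<forall>p. continuation G \<sigma> h p \<longrightarrow> (\<exists>n. p n \<in> verts G - set h)))"

end

theory Submission
  imports Defs
begin

text \<open>
  If the visited set \<open>U\<close> contains no closed subset, its vertices can be peeled off one at a time:
  the remaining set \<open>W\<close> is not closed, so some \<open>u \<in> W\<close> has a distance at which no vertex of \<open>W\<close>
  lies. When the Explorer always names this distance, every turn either leaves \<open>U\<close> or moves to a
  vertex that was peeled off earlier, so the token leaves \<open>U\<close> after finitely many turns.
\<close>

lemma play_in_verts:
  assumes "play G s h"
  shows "h \<noteq> [] \<and> set h \<subseteq> verts G"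
  using assms by induction auto

text \<open>\<open>r\<close> records the order of peeling. The distance to name at \<open>x\<close>
  is encoded by a vertex \<open>f x\<close> at that distance, which makes naming it legal.\<close>

lemma peeling_rank:
  assumes "finite U" "U \<subseteq> verts G" "\<And>W. W \<subseteq> U \<Longrightarrow> \<not> closed_set G W"
  shows "\<exists>f (r :: 'a \<Rightarrow> nat). \<forall>x\<in>U. f x \<in> verts G \<and>
           (\<forall>y\<in>U. gdist G x y = gdist G x (f x) \<longrightarrow> r y < r x)"
  using assms
proof (induction U rule: finite_psubset_induct)
  case (psubset U)
  show ?case
  proof (cases "U = {}")
    case True
    then show ?thesis by simp
  next
    case False
    have "\<not> closed_set G U"
      using psubset.prems(2) by simp
    then obtain u v where u: "u \<in> U" and v: "v \<in> verts G"
      and uv: "\<And>y. y \<in> U \<Longrightarrow> gdist G u v \<noteq> gdist G u y"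
      using False psubset.prems(1) unfolding closed_set_def by blast
    have sub: "U - {u} \<subset> U" "U - {u} \<subseteq> verts G"
      using u psubset.prems(1) by blast+
    have not_closed: "\<not> closed_set G W" if "W \<subseteq> U - {u}" for W
      using that psubset.prems(2) by blast
    have "\<exists>f (r :: 'a \<Rightarrow> nat). \<forall>x\<in>U - {u}. f x \<in> verts G \<and>
        (\<forall>y\<in>U - {u}. gdist G x y = gdist G x (f x) \<longrightarrow> r y < r x)"
      by (rule psubset.IH[OF sub not_closed])
    then obtain f and r :: "'a \<Rightarrow> nat" where fr: "\<forall>x\<in>U - {u}. f x \<in> verts G \<and>
        (\<forall>y\<in>U - {u}. gdist G x y = gdist G x (f x) \<longrightarrow> r y < r x)"
      by (elim exE)
    \<comment> \<open>The vertex \<open>u\<close> is peeled first: no vertex of \<open>U\<close>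
      lies at its named distance, so rank 0 suffices. Shifting the other ranks by \<open>Suc\<close>
      lets them admit moves to \<open>u\<close>.\<close>
    let ?f = "f(u := v)" and ?r = "(Suc \<circ> r)(u := 0)"
    have "\<forall>x\<in>U. ?f x \<in> verts G \<and>
        (\<forall>y\<in>U. gdist G x y = gdist G x (?f x) \<longrightarrow> ?r y < ?r x)"
      using fr v uv by (auto dest: sym)
    then show ?thesis by (intro exI)
  qed
qed

lemma can_force_newI:
  fixes r :: "'a \<Rightarrow> nat"
  assumes h: "play G s h"
    and f: "\<And>x. x \<in> set h \<Longrightarrow> f x \<in> verts G"
    and r: "\<And>x y. \<lbrakk>x \<in> set h; y \<in> set h; gdist G x y = gdist G x (f x)\<rbrakk> \<Longrightarrow> r y < r x"
  shows "can_force_new G s h"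
proof -
  \<comment> \<open>A strategy must be legal after every play, but \<open>f\<close> is controlled
    only on \<open>set h\<close>. Elsewhere the distance from the position to itself is
    named.\<close>
  define \<sigma> where
    "\<sigma> h' = gdist G (last h') (if last h' \<in> set h then f (last h') else last h')" for h'
  have "explorer_strategy G s \<sigma>"
    unfolding explorer_strategy_def may_name_def
  proof (intro allI impI)
    fix h' assume "play G s h'"
    then have "last h' \<in> verts G"
      using play_in_verts last_in_set by (metis subsetD)
    then show "\<exists>v\<in>verts G. gdist G (last h') v = \<sigma> h'"
      unfolding \<sigma>_def using f by auto
  qed
  moreover have "\<exists>n. p n \<in> verts G - set h" if p: "continuation G \<sigma> h p" for p
  proof (rule ccontr)
    assume stay: "\<nexists>n. p n \<in> verts G - set h"
    have p0: "p 0 = last h" and pS: "\<And>n. p (Suc n) \<in> verts G"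
      and move: "\<And>n. gdist G (p n) (p (Suc n)) = \<sigma> (h @ map p [1..<Suc n])"
      using p unfolding continuation_def by auto
    \<comment> \<open>For \<open>n = 0\<close> the appended list is empty, and the last entry is
      that of \<open>h\<close>, which is \<open>p 0\<close>.\<close>
    have pos: "last (h @ map p [1..<Suc n]) = p n" for n
      using p0 by (cases n) auto
    have visited: "p n \<in> set h" for n
    proof (cases n)
      case 0
      then show ?thesis using p0 play_in_verts[OF h] by simp
    next
      case (Suc m)
      then show ?thesis using pS[of m] stay by blast
    qed
    \<comment> \<open>Since the token never leaves \<open>set h\<close>, each named distance comes
      from \<open>f\<close>, so the ranks would descend forever.\<close>
    have "r (p (Suc n)) < r (p n)" for n
      using r[OF visited visited] move[of n] visited[of n] unfolding \<sigma>_def pos by simp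
    then show False
      using wf_no_infinite_down_chainE[OF wf_measure[of r], of p] by auto
  qed
  ultimately show ?thesis
    unfolding can_force_new_def by blast
qed

theorem theorem2p3:
  fixes G :: "('a, 'b) pre_digraph" and s :: 'a and h :: "'a list"
  assumes "graph G"
    and "Digraph_Component.connected G"
    and "play G s h"
    and "\<not> can_force_new G s h"
  shows "\<exists>W. W \<subseteq> set h \<and> closed_set G W"
proof (rule ccontr)
  assume "\<not> ?thesis"
  \<comment> \<open>The negated goal says that no subset of \<open>set h\<close> is closed, so this
    finite set can be peeled completely.\<close>
  then obtain f and r :: "'a \<Rightarrow> nat" where "\<forall>x\<in>set h. f x \<in> verts G \<and>
      (\<forall>y\<in>set h. gdist G x y = gdist G x (f x) \<longrightarrow> r y < r x)"
    using peeling_rank[of "set h" G] play_in_verts[OF assms(3)] by auto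
  then have "can_force_new G s h"
    using can_force_newI[OF assms(3), of f r] by blast
  with assms(4) show False ..
qed

end
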